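(* Let $\mathcal H,\mathcal K$ be complex Hilbert spaces. The relation $\overset{+}{\leq}$ (the plus order) is a partial order on $L(\mathcal H,\mathcal K)$.
   Context: $L(\mathcal H,\mathcal K)$ is the set of bounded linear operators from $\mathcal H$ to $\mathcal K$, $L(\mathcal H)=L(\mathcal H,\mathcal H)$; $R(T)$ is the range of $T$. A projection is a bounded idempotent operator (not necessarily orthogonal). Plus order: for $A,B\in L(\mathcal H,\mathcal K)$, $A\overset{+}{\leq}B$ if $R(A)\subseteq R(B)$, $R(A^* )\subseteq R(B^* )$ and there are projections $\tilde Q\in L(\mathcal K)$ and $Q\in L(\mathcal H)$ such that $A=\tilde QBQ$. *)

theory Defs
  imports "HOL-Analysis.Analysis"
begin

text \<open>Complex inner product spaces. The real structure of the library class (addition, norm,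
  topology, real inner product) is the one underlying the complex structure: the real scalar
  multiplication is the restriction of the complex one, and the real inner product is the real part
  of the complex one, so that the norm of x is the square root of \<open>cinner x x\<close>.
  The complex inner product is linear in its first argument.\<close>

class complex_inner = real_inner +
  fixes scaleC :: "complex \<Rightarrow> 'a \<Rightarrow> 'a"  (infixr \<open>*\<^sub>C\<close> 75)
    and cinner :: "'a \<Rightarrow> 'a \<Rightarrow> complex"
  assumes scaleC_add_right: "c *\<^sub>C (x + y) = c *\<^sub>C x + c *\<^sub>C y"
    and scaleC_add_left: "(c + d) *\<^sub>C x = c *\<^sub>C x + d *\<^sub>C x"
    and scaleC_scaleC: "c *\<^sub>C (d *\<^sub>C x) = (c * d) *\<^sub>C x"
    and scaleC_one: "1 *\<^sub>C x = x"
    and scaleR_scaleC: "scaleR r x = complex_of_real r *\<^sub>C x"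
    and cinner_commute: "cinner x y = cnj (cinner y x)"
    and cinner_add_left: "cinner (x + y) z = cinner x z + cinner y z"
    and cinner_scaleC_left: "cinner (c *\<^sub>C x) y = c * cinner x y"
    and inner_eq_Re_cinner: "inner x y = Re (cinner x y)"

class complex_hilbert_space = complex_inner + complete_space

instantiation complex :: complex_hilbert_space
begin

definition scaleC_complex_def: "c *\<^sub>C (z :: complex) = c * z"

definition cinner_complex_def: "cinner (z :: complex) w = z * cnj w"

instance
  by standard
    (simp_all add: scaleC_complex_def cinner_complex_def inner_complex_def algebra_simps
      scaleR_conv_of_real)

end

text \<open>The library predicate \<open>bounded_linear\<close> only expresses real linearity.\<close>

definition bounded_ops :: "('h::complex_hilbert_space \<Rightarrow> 'k::complex_hilbert_space) set" where
  "bounded_ops = {T. bounded_linear T \<and> (\<forall>c x. T (c *\<^sub>C x) = c *\<^sub>C T x)}"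

text \<open>At most one function satisfies the defining condition, because the inner product is
  nondegenerate; for bounded operators the Riesz representation theorem provides one.\<close>

definition cadjoint ::
  "('h::complex_hilbert_space \<Rightarrow> 'k::complex_hilbert_space) \<Rightarrow> 'k \<Rightarrow> 'h" where
  "cadjoint T = (THE S. \<forall>x y. cinner (T x) y = cinner x (S y))"

definition projections :: "('h::complex_hilbert_space \<Rightarrow> 'h) set" where
  "projections = {Q. Q \<in> bounded_ops \<and> Q \<circ> Q = Q}"

definition plus_le ::
  "('h::complex_hilbert_space \<Rightarrow> 'k::complex_hilbert_space) \<Rightarrow> ('h \<Rightarrow> 'k) \<Rightarrow> bool" where
  "plus_le A B \<longleftrightarrow>
     range A \<subseteq> range B \<and> range (cadjoint A) \<subseteq> range (cadjoint B) \<and>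
     (\<exists>Q' \<in> projections. \<exists>Q \<in> projections. A = Q' \<circ> B \<circ> Q)"

end

theory Submission
  imports Defs
begin

text \<open>For transitivity, let \<open>A = Q' B Q\<close> and \<open>B = P' C P\<close>. The product \<open>Q' P'\<close> is not idempotent
  in general, but \<open>Q'\<close> may be replaced by \<open>E Q'\<close>, where \<open>E\<close> projects onto
  \<open>ran P' \<inter> ran Q'\<close>: this subspace contains \<open>ran A\<close>, so \<open>A = E A\<close>, and now \<open>P'\<close> fixes the range
  of \<open>E Q'\<close>, so \<open>E Q' P'\<close> is idempotent. Dually, \<open>Q\<close> is replaced by \<open>Q (1 - N)\<close>,
  where \<open>N\<close> projects onto \<open>ker A\<close>; the condition on the adjoints enters through
  \<open>ker P \<subseteq> ker B \<subseteq> ker A\<close>.\<close>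

subsection \<open>Orthogonal projection and Riesz representation\<close>

text \<open>A minimizing sequence for the squared distance to \<open>S\<close> is Cauchy by the
  parallelogram law. Completeness and closedness give a nearest point \<open>p\<close> in
  \<open>S\<close>, and minimality makes \<open>x - p\<close> orthogonal to
  \<open>S\<close>.\<close>

lemma closed_subspace_orthogonal_decomposition:
  fixes S :: "'a::{real_inner, complete_space} set"
  assumes sub: "subspace S" and cl: "closed S"
  shows "\<exists>p\<in>S. \<forall>s\<in>S. inner (x - p) s = 0"
proof -
  define D where "D = (INF s\<in>S. (norm (x - s))\<^sup>2)"
  have bdd: "bdd_below ((\<lambda>s. (norm (x - s))\<^sup>2) ` S)"
    by (rule bdd_belowI[of _ 0]) auto
  have ne: "S \<noteq> {}" using subspace_0[OF sub] by auto
  have D_le: "D \<le> (norm (x - s))\<^sup>2" if "s \<in> S" for s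
    unfolding D_def by (rule cINF_lower[OF bdd that])
  have "\<exists>s\<in>S. (norm (x - s))\<^sup>2 < D + inverse (real (Suc n))" for n
    using cINF_less_iff[OF ne bdd, of "D + inverse (real (Suc n))"] by (simp add: D_def)
  then obtain s where sS: "\<And>n. s n \<in> S"
    and s_less: "\<And>n. (norm (x - s n))\<^sup>2 < D + inverse (real (Suc n))"
    by metis
  have parallelogram: "(norm (s m - s n))\<^sup>2 \<le> 2 * inverse (real (Suc m)) + 2 * inverse (real (Suc n))"
    for m n
  proof -
    \<comment> \<open>The midpoint lies in \<open>S\<close>, so its squared distance to
      \<open>x\<close> is at least \<open>D\<close>; this turns the parallelogram law into a bound
      on the gap.\<close>
    have "(1/2) *\<^sub>R (s m + s n) \<in> S"
      using sS sub by (intro subspace_scale subspace_add)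
    from D_le[OF this] have "4 * D \<le> 4 * (norm (x - (1/2) *\<^sub>R (s m + s n)))\<^sup>2" by simp
    moreover have "(norm (s m - s n))\<^sup>2 + 4 * (norm (x - (1/2) *\<^sub>R (s m + s n)))\<^sup>2
        = 2 * (norm (x - s m))\<^sup>2 + 2 * (norm (x - s n))\<^sup>2"
    proof -
      define u v where "u = x - s m" and "v = x - s n"
      have "s m - s n = v - u" by (simp add: u_def v_def)
      moreover have "x - (1/2) *\<^sub>R (s m + s n) = (1/2) *\<^sub>R (u + v)"
        using scaleR_half_double[of x]
        by (simp add: u_def v_def scaleR_add_right scaleR_diff_right)
      ultimately have "(norm (s m - s n))\<^sup>2 + 4 * (norm (x - (1/2) *\<^sub>R (s m + s n)))\<^sup>2
          = (norm (v - u))\<^sup>2 + (norm (u + v))\<^sup>2"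
        by (simp add: power_divide)
      also have "\<dots> = 2 * (norm u)\<^sup>2 + 2 * (norm v)\<^sup>2"
        unfolding power2_norm_eq_inner
        by (simp add: inner_diff_left inner_diff_right inner_add_left inner_add_right
            inner_commute[of v u])
      finally show ?thesis by (simp only: u_def v_def)
    qed
    ultimately show ?thesis using s_less[of m] s_less[of n] by linarith
  qed
  have "Cauchy s"
  proof (rule metric_CauchyI)
    fix e :: real assume "0 < e"
    then have "0 < e\<^sup>2 / 4" by simp
    then obtain N where N: "inverse (real (Suc N)) < e\<^sup>2 / 4" using reals_Archimedean by blast
    show "\<exists>M. \<forall>m\<ge>M. \<forall>n\<ge>M. dist (s m) (s n) < e"
    proof (intro exI allI impI)
      fix m n assume "N \<le> m" "N \<le> n"
      then have "inverse (real (Suc m)) \<le> inverse (real (Suc N))"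
        "inverse (real (Suc n)) \<le> inverse (real (Suc N))"
        by (auto intro!: le_imp_inverse_le)
      with N parallelogram[of m n] have "(norm (s m - s n))\<^sup>2 < e\<^sup>2" by linarith
      then show "dist (s m) (s n) < e"
        using \<open>0 < e\<close> by (simp add: dist_norm power2_less_imp_less)
    qed
  qed
  then obtain p where lim: "s \<longlonglongrightarrow> p" using Cauchy_convergent convergent_def by blast
  have pS: "p \<in> S" using closed_sequentially[OF cl] sS lim by blast
  have "(\<lambda>n. (norm (x - s n))\<^sup>2) \<longlonglongrightarrow> (norm (x - p))\<^sup>2" by (intro tendsto_intros lim)
  moreover have "(\<lambda>n. D + inverse (real (Suc n))) \<longlonglongrightarrow> D + 0"
    by (intro tendsto_intros LIMSEQ_inverse_real_of_nat)
  ultimately have p_le: "(norm (x - p))\<^sup>2 \<le> D"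
    using LIMSEQ_le[of _ "(norm (x - p))\<^sup>2" _ "D + 0"] s_less by (force intro: less_imp_le)
  have "inner (x - p) v = 0" if v: "v \<in> S" for v
  proof (cases "v = 0")
    case False
    \<comment> \<open>This \<open>t\<close> minimizes the distance from \<open>x - p\<close> to the
      line through \<open>v\<close>; a nonzero inner product would put
      \<open>p + t *\<^sub>R v\<close> strictly closer to \<open>x\<close> than
      \<open>p\<close>.\<close>
    define t where "t = inner (x - p) v / inner v v"
    have vv: "inner v v > 0" using False by simp
    have "p + t *\<^sub>R v \<in> S" using pS v sub by (intro subspace_add subspace_scale)
    from D_le[OF this] p_le have "(norm (x - p))\<^sup>2 \<le> (norm ((x - p) - t *\<^sub>R v))\<^sup>2"
      unfolding diff_diff_eq by (rule order_trans[rotated])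
    also have "\<dots> = (norm (x - p))\<^sup>2 - 2 * t * inner (x - p) v + t * (t * inner v v)"
    proof -
      have "(norm (q - t *\<^sub>R v))\<^sup>2 = (norm q)\<^sup>2 - 2 * t * inner q v + t * (t * inner v v)" for q
        unfolding power2_norm_eq_inner
        by (simp add: inner_diff_left inner_diff_right inner_commute[of v q] ring_distribs)
      then show ?thesis .
    qed
    also have "t * inner v v = inner (x - p) v" using vv by (simp add: t_def)
    finally have "t * inner (x - p) v \<le> 0" by simp
    then have "(inner (x - p) v)\<^sup>2 / inner v v \<le> 0" by (simp add: t_def power2_eq_square)
    then show ?thesis using vv by (simp add: divide_le_0_iff)
  qed simp
  with pS show ?thesis by blast
qed

text \<open>For nonzero \<open>f\<close>, the vector \<open>u\<close> is orthogonal to the kernel,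
  and every \<open>x\<close> is a multiple of \<open>u\<close> plus a kernel vector; hence a
  suitable multiple of \<open>u\<close> represents \<open>f\<close>.\<close>

lemma riesz_representation:
  fixes f :: "'a::{real_inner, complete_space} \<Rightarrow> real"
  assumes f: "bounded_linear f"
  shows "\<exists>y. \<forall>x. f x = inner x y"
proof (cases "\<forall>x. f x = 0")
  case True
  then show ?thesis by (intro exI[of _ 0]) simp
next
  case False
  then obtain w where w: "f w \<noteq> 0" by blast
  interpret f: bounded_linear f by (fact f)
  have "subspace {x. f x = 0}" by (simp add: subspace_def f.add f.scaleR f.zero)
  moreover have "closed {x. f x = 0}"
    by (intro closed_Collect_eq continuous_on_const f.continuous_on continuous_on_id)
  ultimately obtain p where p: "f p = 0" "\<And>s. f s = 0 \<Longrightarrow> inner (w - p) s = 0"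
    using closed_subspace_orthogonal_decomposition[of "{x. f x = 0}" w] by blast
  define u where "u = w - p"
  have fu: "f u \<noteq> 0" using w p(1) by (simp add: u_def f.diff)
  then have uu: "inner u u \<noteq> 0" by (auto simp: f.zero)
  have "f x = inner x ((f u / inner u u) *\<^sub>R u)" for x
  proof -
    have "f (x - (f x / f u) *\<^sub>R u) = 0" using fu by (simp add: f.diff f.scaleR)
    from p(2)[OF this] have "inner u x = (f x / f u) * inner u u"
      by (simp add: u_def[symmetric] inner_diff_right)
    then show ?thesis using fu uu by (simp add: inner_commute)
  qed
  then show ?thesis by blast
qed

subsection \<open>Complex structure and adjoints\<close>

lemma scaleC_zero_right: "c *\<^sub>C (0::'a::complex_inner) = 0"
  using scaleC_add_right[of c 0 "0::'a"] by simp

lemma scaleC_minus_right: "c *\<^sub>C (- x :: 'a::complex_inner) = - (c *\<^sub>C x)"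
  using scaleC_add_right[of c x "- x"] by (simp add: scaleC_zero_right eq_neg_iff_add_eq_0 add.commute)

lemma scaleC_diff_right: "c *\<^sub>C (x - y :: 'a::complex_inner) = c *\<^sub>C x - c *\<^sub>C y"
  using scaleC_add_right[of c x "- y"] by (simp add: scaleC_minus_right)

lemma cinner_zero_left: "cinner 0 (x::'a::complex_inner) = 0"
  using cinner_add_left[of 0 0 x] by simp

lemma cinner_scaleC_right: "cinner (x::'a::complex_inner) (c *\<^sub>C y) = cnj c * cinner x y"
  by (metis cinner_commute cinner_scaleC_left complex_cnj_mult)

text \<open>Because Im z = - Re (\<i> z), the real inner product determines the complex one, so the
  real Riesz theorem suffices for complex adjoints.\<close>

lemma cinner_eq_Complex_inner:
  "cinner (x::'a::complex_inner) y = Complex (inner x y) (- inner (\<i> *\<^sub>C x) y)"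
  by (simp add: complex_eq_iff inner_eq_Re_cinner cinner_scaleC_left)

lemma ex_adjoint:
  fixes T :: "'h::complex_hilbert_space \<Rightarrow> 'k::complex_hilbert_space"
  assumes T: "T \<in> bounded_ops"
  shows "\<exists>S. \<forall>x y. cinner (T x) y = cinner x (S y)"
proof -
  have "bounded_linear (\<lambda>x. inner (T x) y)" for y
    using T by (intro bounded_linear_compose[OF bounded_linear_inner_left]) (simp add: bounded_ops_def)
  then have "\<exists>z. \<forall>x. inner (T x) y = inner x z" for y
    by (rule riesz_representation)
  then obtain S where S: "\<And>x y. inner (T x) y = inner x (S y)" by metis
  have "cinner (T x) y = cinner x (S y)" for x y
    \<comment> \<open>\<open>T\<close> commutes with multiplication by \<i>, so the real identity
      also settles the imaginary part.\<close>
    using T by (simp add: cinner_eq_Complex_inner S[symmetric] bounded_ops_def)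
  then show ?thesis by blast
qed

lemma cadjoint_cinner:
  fixes T :: "'h::complex_hilbert_space \<Rightarrow> 'k::complex_hilbert_space"
  assumes "T \<in> bounded_ops"
  shows "cinner (T x) y = cinner x (cadjoint T y)"
proof -
  obtain S where S: "\<forall>x y. cinner (T x) y = cinner x (S y)" using ex_adjoint[OF assms] by blast
  have "\<forall>x y. cinner (T x) y = cinner x (cadjoint T y)"
    unfolding cadjoint_def
  proof (rule theI[of _ S])
    fix S' assume S': "\<forall>x y. cinner (T x) y = cinner x (S' y)"
    show "S' = S"
    proof
      fix y
      have "inner x (S' y) = inner x (S y)" for x
        using S S' by (simp add: inner_eq_Re_cinner)
      then show "S' y = S y" by (metis vector_eq_ldot)
    qed
  qed (fact S)
  then show ?thesis by blast
qed

text \<open>Writing A* A x = B* z gives <A x, A x> = <x, B* z> = <B x, z> = 0. This is how the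
  condition on the adjoints becomes usable: as an inclusion of kernels.\<close>

lemma kernel_subset_of_range_cadjoint_subset:
  assumes A: "A \<in> bounded_ops" and B: "B \<in> bounded_ops"
    and sub: "range (cadjoint A) \<subseteq> range (cadjoint B)" and Bx: "B x = 0"
  shows "A x = 0"
proof -
  obtain z where z: "cadjoint A (A x) = cadjoint B z" using sub by blast
  have "cinner (A x) (A x) = cinner (B x) z"
    by (simp add: cadjoint_cinner[OF A] cadjoint_cinner[OF B] z)
  then have "inner (A x) (A x) = 0" by (simp add: Bx cinner_zero_left inner_eq_Re_cinner)
  then show ?thesis by simp
qed

subsection \<open>Projections\<close>

lemma bounded_ops_comp: "S \<in> bounded_ops \<Longrightarrow> T \<in> bounded_ops \<Longrightarrow> S \<circ> T \<in> bounded_ops"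
  by (auto simp: bounded_ops_def o_def intro: bounded_linear_compose)

lemma bounded_ops_diff:
  "S \<in> bounded_ops \<Longrightarrow> T \<in> bounded_ops \<Longrightarrow> (\<lambda>x. S x - T x) \<in> bounded_ops"
  by (auto simp: bounded_ops_def scaleC_diff_right intro: bounded_linear_sub)

lemma id_in_projections: "id \<in> projections"
  by (auto simp: projections_def bounded_ops_def id_def bounded_linear_ident)

lemma bounded_ops_linear: "T \<in> bounded_ops \<Longrightarrow> linear T"
  by (simp add: bounded_ops_def bounded_linear.linear)

lemma bounded_ops_continuous_on: "T \<in> bounded_ops \<Longrightarrow> continuous_on S T"
  by (simp add: bounded_ops_def linear_continuous_on)

lemma bounded_ops_scaleC: "T \<in> bounded_ops \<Longrightarrow> T (c *\<^sub>C x) = c *\<^sub>C T x"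
  by (simp add: bounded_ops_def)

lemma projections_in_bounded_ops: "Q \<in> projections \<Longrightarrow> Q \<in> bounded_ops"
  by (simp add: projections_def)

lemma projections_idem: "Q \<in> projections \<Longrightarrow> Q (Q x) = Q x"
  by (auto simp: projections_def fun_eq_iff)

lemma ex_projection_onto:
  fixes S :: "'h::complex_hilbert_space set"
  assumes sub: "subspace S" and scaleC: "\<And>c x. x \<in> S \<Longrightarrow> c *\<^sub>C x \<in> S" and cl: "closed S"
  shows "\<exists>Q \<in> projections. range Q \<subseteq> S \<and> (\<forall>x\<in>S. Q x = x)"
proof -
  obtain Q where QS: "\<And>x. Q x \<in> S" and orth: "\<And>x s. s \<in> S \<Longrightarrow> inner (x - Q x) s = 0"
    using closed_subspace_orthogonal_decomposition[OF sub cl] by metis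
  \<comment> \<open>Uniqueness of the orthogonal foot point: each algebraic law for \<open>Q\<close>
    reduces to membership in \<open>S\<close> and an orthogonality check.\<close>
  have eqI: "Q x = p" if p: "p \<in> S" and xp: "\<And>s. s \<in> S \<Longrightarrow> inner (x - p) s = 0" for x p
  proof -
    have d: "Q x - p \<in> S" using QS p sub by (intro subspace_diff)
    have "inner (Q x - p) (Q x - p) = inner (x - p) (Q x - p) - inner (x - Q x) (Q x - p)"
      by (simp add: inner_diff_left)
    also have "\<dots> = 0" using xp[OF d] orth[OF d] by simp
    finally show ?thesis by simp
  qed
  have lin: "linear Q"
  proof
    show "Q (x + y) = Q x + Q y" for x y
    proof (rule eqI)
      fix s assume "s \<in> S"
      from orth[OF this, of x] orth[OF this, of y] show "inner (x + y - (Q x + Q y)) s = 0"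
        by (simp add: inner_diff_left inner_add_left)
    qed (intro subspace_add sub QS)
    show "Q (r *\<^sub>R x) = r *\<^sub>R Q x" for r x
    proof (rule eqI)
      fix s assume "s \<in> S"
      from orth[OF this, of x] show "inner (r *\<^sub>R x - r *\<^sub>R Q x) s = 0"
        by (simp add: inner_diff_left)
    qed (intro subspace_scale sub QS)
  qed
  have "norm (Q x) \<le> norm x * 1" for x
  proof -
    have "norm (Q x) * norm (Q x) = inner x (Q x)"
      using orth[OF QS, of x x] by (simp add: inner_diff_left dot_square_norm power2_eq_square)
    also have "\<dots> \<le> norm x * norm (Q x)" by (rule norm_cauchy_schwarz)
    finally show ?thesis using mult_right_le_imp_le[of "norm (Q x)" "norm (Q x)" "norm x"]
      by (cases "Q x = 0") auto
  qed
  then have bl: "bounded_linear Q"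
    using lin unfolding bounded_linear_def bounded_linear_axioms_def by blast
  have "Q (c *\<^sub>C x) = c *\<^sub>C Q x" for c x
  proof (rule eqI)
    fix s assume s: "s \<in> S"
    \<comment> \<open>The scalar moves to the other side as \<open>cnj c\<close>, and
      \<open>S\<close> is closed under complex scaling.\<close>
    have "inner (c *\<^sub>C x - c *\<^sub>C Q x) s = inner (x - Q x) (cnj c *\<^sub>C s)"
      by (simp add: inner_eq_Re_cinner cinner_scaleC_right cinner_scaleC_left
          flip: scaleC_diff_right)
    also have "\<dots> = 0" by (intro orth scaleC s)
    finally show "inner (c *\<^sub>C x - c *\<^sub>C Q x) s = 0" .
  qed (intro scaleC QS)
  moreover have fix_S: "Q x = x" if "x \<in> S" for x by (rule eqI[OF that]) simp
  ultimately have "Q \<in> projections"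
    using bl QS by (auto simp: projections_def bounded_ops_def)
  with QS fix_S show ?thesis by blast
qed

subsection \<open>The plus order\<close>

text \<open>Since ran B lies in ran A and hence in ran Q', \<open>Q'\<close> fixes ran B and A = B
  Q. As 1 - Q maps into ker A, which lies in ker B, also B Q = B.\<close>

lemma plus_le_antisym:
  fixes A B :: "'h::complex_hilbert_space \<Rightarrow> 'k::complex_hilbert_space"
  assumes A: "A \<in> bounded_ops" and B: "B \<in> bounded_ops"
    and AB: "plus_le A B" and BA: "plus_le B A"
  shows "A = B"
proof
  fix x
  obtain Q' Q where Q': "Q' \<in> projections" and Q: "Q \<in> projections" and eq: "A = Q' \<circ> B \<circ> Q"
    using AB by (auto simp: plus_le_def)
  have fixB: "Q' (B y) = B y" for y
  proof -
    have "B y \<in> range A" using BA by (auto simp: plus_le_def)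
    then show ?thesis by (auto simp: eq projections_idem[OF Q'])
  qed
  have "A (x - Q x) = 0"
    by (simp add: linear_diff[OF bounded_ops_linear[OF A]]) (simp add: eq projections_idem[OF Q])
  then have "B (x - Q x) = 0"
    using kernel_subset_of_range_cadjoint_subset[OF B A] BA by (auto simp: plus_le_def)
  then have "B x = B (Q x)" by (simp add: linear_diff[OF bounded_ops_linear[OF B]])
  then show "A x = B x" by (simp add: eq fixB)
qed

lemma plus_le_trans:
  fixes A B C :: "'h::complex_hilbert_space \<Rightarrow> 'k::complex_hilbert_space"
  assumes A: "A \<in> bounded_ops" and B: "B \<in> bounded_ops"
    and AB: "plus_le A B" and BC: "plus_le B C"
  shows "plus_le A C"
proof -
  obtain Q' Q where Q': "Q' \<in> projections" and Q: "Q \<in> projections" and A_eq: "A = Q' \<circ> B \<circ> Q"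
    using AB by (auto simp: plus_le_def)
  obtain P' P where P': "P' \<in> projections" and P: "P \<in> projections" and B_eq: "B = P' \<circ> C \<circ> P"
    using BC by (auto simp: plus_le_def)
  note bd = Q'[THEN projections_in_bounded_ops] Q[THEN projections_in_bounded_ops]
    P'[THEN projections_in_bounded_ops] P[THEN projections_in_bounded_ops]
  note lin = A[THEN bounded_ops_linear] B[THEN bounded_ops_linear] bd[THEN bounded_ops_linear]
  have kernel: "A x = 0" if "B x = 0" for x
    using kernel_subset_of_range_cadjoint_subset[OF A B _ that] AB by (simp add: plus_le_def)

  \<comment> \<open>The range of an idempotent is its fixed-point set, so this is ran P' \<inter>
    ran Q' in a form that is visibly closed.\<close>
  let ?M = "{y. P' y = y \<and> Q' y = y}"
  have "\<exists>E \<in> projections. range E \<subseteq> ?M \<and> (\<forall>y\<in>?M. E y = y)"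
  proof (rule ex_projection_onto)
    show "subspace ?M"
      using lin by (simp add: subspace_def linear_add linear_scale linear_0)
    show "closed ?M"
      by (intro closed_Collect_conj closed_Collect_eq bounded_ops_continuous_on continuous_on_id bd)
  qed (simp add: bounded_ops_scaleC bd)
  then obtain E where E: "E \<in> projections" and E_fixed: "\<And>y. P' (E y) = E y" "\<And>y. Q' (E y) = E y"
    and E_fix: "\<And>y. P' y = y \<Longrightarrow> Q' y = y \<Longrightarrow> E y = y"
    by (auto simp: image_subset_iff)
  have EA: "E (A x) = A x" for x
  proof (rule E_fix)
    have "A x \<in> range B" using AB by (auto simp: plus_le_def)
    then show "P' (A x) = A x" by (auto simp: B_eq projections_idem[OF P'])
    show "Q' (A x) = A x" by (simp add: A_eq projections_idem[OF Q'])
  qed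

  have "\<exists>N \<in> projections. range N \<subseteq> {x. A x = 0} \<and> (\<forall>x\<in>{x. A x = 0}. N x = x)"
  proof (rule ex_projection_onto)
    show "subspace {x. A x = 0}" by (intro linear_subspace_kernel lin)
    show "closed {x. A x = 0}"
      by (intro closed_Collect_eq bounded_ops_continuous_on continuous_on_const A)
  qed (simp add: bounded_ops_scaleC[OF A] scaleC_zero_right)
  then obtain N where N: "N \<in> projections" and AN: "\<And>x. A (N x) = 0"
    and N_fix: "\<And>x. A x = 0 \<Longrightarrow> N x = x"
    by (auto simp: image_subset_iff)
  have N_lin: "linear N" using N by (intro bounded_ops_linear projections_in_bounded_ops)
  define J where "J x = x - N x" for x
  have J: "J \<in> bounded_ops"
    using bounded_ops_diff[OF projections_in_bounded_ops[OF id_in_projections]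
        projections_in_bounded_ops[OF N]]
    by (simp add: J_def[abs_def])
  \<comment> \<open>If A x = A y, then x - y lies in ker A, where \<open>N\<close> is the identity.
    Thus J T = J follows from A T = A, for T = Q, P and \<open>J\<close> itself.\<close>
  have J_cong: "J x = J y" if "A x = A y" for x y
    using N_fix[of "x - y"] that
    by (simp add: linear_diff[OF lin(1)] linear_diff[OF N_lin] J_def algebra_simps)
  have AJ: "A (J x) = A x" for x by (simp add: J_def linear_diff[OF lin(1)] AN)
  have JQ: "J (Q x) = J x" for x by (rule J_cong) (simp add: A_eq projections_idem[OF Q])
  have JP: "J (P x) = J x" for x
  proof (rule J_cong)
    have "B (P x - x) = 0"
      by (simp add: linear_diff[OF lin(2)]) (simp add: B_eq projections_idem[OF P])
    from kernel[OF this] show "A (P x) = A x" by (simp add: linear_diff[OF lin(1)])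
  qed
  have JJ: "J (J x) = J x" for x by (rule J_cong) (rule AJ)

  \<comment> \<open>Both \<open>P'\<close> and \<open>Q'\<close> fix ran E, so the middle factors of
    the square collapse; dually, \<open>J\<close> absorbs \<open>P\<close>, \<open>Q\<close> and
    \<open>J\<close> on its right.\<close>
  have "E \<circ> Q' \<circ> P' \<in> projections"
    using E Q' P' by (auto simp: projections_def E_fixed fun_eq_iff intro!: bounded_ops_comp)
  moreover have "P \<circ> Q \<circ> J \<in> projections"
    using P Q J by (auto simp: projections_def JP JQ JJ fun_eq_iff intro!: bounded_ops_comp)
  moreover have "A = (E \<circ> Q' \<circ> P') \<circ> C \<circ> (P \<circ> Q \<circ> J)"
  proof
    fix x
    \<comment> \<open>Inserting A = Q' B Q and B = P' C P into A = E A J yields the required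
      factorization through \<open>C\<close>.\<close>
    have "A x = E (A (J x))" by (simp add: EA AJ)
    then show "A x = ((E \<circ> Q' \<circ> P') \<circ> C \<circ> (P \<circ> Q \<circ> J)) x" by (simp add: A_eq B_eq)
  qed
  moreover have "range A \<subseteq> range C" "range (cadjoint A) \<subseteq> range (cadjoint C)"
    using AB BC unfolding plus_le_def by blast+
  ultimately show ?thesis unfolding plus_le_def by blast
qed

theorem lemma3p8:
  shows "partial_order_on
    (bounded_ops :: ('h::complex_hilbert_space \<Rightarrow> 'k::complex_hilbert_space) set)
    {(A, B). A \<in> bounded_ops \<and> B \<in> bounded_ops \<and> plus_le A B}"
proof -
  \<comment> \<open>Reflexivity takes the identity for both projections.\<close>
  have "plus_le A A" for A :: "'h \<Rightarrow> 'k"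
    unfolding plus_le_def by (auto intro!: bexI[of _ id] id_in_projections)
  then show ?thesis
    unfolding partial_order_on_def preorder_on_def
    by (auto simp: refl_on_def intro!: transI antisymI intro: plus_le_trans dest: plus_le_antisym)
qed

end
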